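(* Let $T=\{0,\dots,N\}$ and $\mathbb{F}$ a field. Let $C_\bullet$, $C'_\bullet$ be filtrations of finite-dimensional chain complexes $C$, $C'$ over $\mathbb{F}$ with filtration compatible ordered bases $\mathfrak{C}=(c_1,\dots,c_n)$, $\mathfrak{C}'=(c'_1,\dots,c'_n)$ and filtration boundary matrices $D$, $D'$. Let $\varphi_\bullet\colon C_\bullet\to C'_\bullet$ be an injective morphism of filtrations of chain complexes with $\varphi=\varphi_N$ an isomorphism, $F$ its matrix with respect to $\mathfrak{C},\mathfrak{C}'$, and $D^{\varphi}=DF^{-1}=F^{-1}D'$. Let $V$, $V^{\varphi}$ be invertible upper-triangular matrices such that $R=DV$ and $R^{\varphi}=D^{\varphi}V^{\varphi}$ are reduced; interpret columns of $R^{\varphi}$ as elements of $C$ via coordinates in $\mathfrak{C}$ and columns of $V^{\varphi}$ and $FR^{\varphi}$ as elements of $C'$ via coordinates in $\mathfrak{C}'$. Then $\mathfrak{B}=\operatorname{cols}FR^{\varphi}$ is a filtration compatible basis for the filtration $\varphi_\bullet(Z_*(C_\bullet))\cap B_*(C'_\bullet)$, $t\mapsto\varphi_t(\ker\partial|_{C_t})\cap\partial(C'_t)$, and for all $j$ with $r^{\varphi}_j\neq0$, \[ \operatorname{supp}_{\varphi_\bullet(Z_*(C_\bullet))\cap B_*(C'_\bullet)}(Fr^{\varphi}_j)=\operatorname{supp}_{C_\bullet}(r^{\varphi}_j)\cap\operatorname{supp}_{C'_\bullet}(v^{\varphi}_j). \]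
   Context: A chain complex is a finite-dimensional graded vector space with differential $\partial$ of degree $-1$, $\partial^2=0$; a filtration of chain complexes is a chain of subcomplexes $C_0\subseteq\dots\subseteq C_N=C$. Support: $\operatorname{supp}_{M_\bullet}(m)=\{t\mid m\in M_t\}$. A basis $\mathfrak{M}$ of $M_N$ is filtration compatible if $\mathfrak{M}\cap M_t$ is a basis of $M_t$ for all $t$; an ordered such basis is a filtration compatible ordered basis if $m\le m'$ implies $\operatorname{supp}(m')\subseteq\operatorname{supp}(m)$. The filtration boundary matrix is the matrix of $\partial$ in that basis. For a matrix $X$, $x_j$ is its $j$-th column, $\operatorname{cols}X$ the family of its nonzero columns; $\operatorname{piv}x_j$ is the largest row index of a nonzero entry of a nonzero column; $X$ is reduced if no two nonzero columns have the same pivot. *)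

theory Defs
  imports "Jordan_Normal_Form.Matrix"
begin

text \<open>Vectors of the coordinate space F^n (coordinates w.r.t. the chosen ordered basis).
  Index set T = {0..N}.\<close>

definition lin_comb :: "nat \<Rightarrow> ('j \<Rightarrow> 'a::field vec) \<Rightarrow> 'j set \<Rightarrow> ('j \<Rightarrow> 'a) \<Rightarrow> 'a vec" where
  "lin_comb n b J c = vec n (\<lambda>i. \<Sum>j\<in>J. c j * (b j $ i))"

definition span_fam :: "nat \<Rightarrow> ('j \<Rightarrow> 'a::field vec) \<Rightarrow> 'j set \<Rightarrow> 'a vec set" where
  "span_fam n b J = {lin_comb n b J c | c. True}"

definition lin_indep_fam :: "nat \<Rightarrow> ('j \<Rightarrow> 'a::field vec) \<Rightarrow> 'j set \<Rightarrow> bool" where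
  "lin_indep_fam n b J \<longleftrightarrow> (\<forall>c. lin_comb n b J c = 0\<^sub>v n \<longrightarrow> (\<forall>j\<in>J. c j = 0))"

text \<open>The finite family (b j) indexed by J is a basis of the subspace M of F^n.\<close>
definition basis_fam :: "nat \<Rightarrow> ('j \<Rightarrow> 'a::field vec) \<Rightarrow> 'j set \<Rightarrow> 'a vec set \<Rightarrow> bool" where
  "basis_fam n b J M \<longleftrightarrow> finite J \<and> (\<forall>j\<in>J. b j \<in> carrier_vec n) \<and>
     lin_indep_fam n b J \<and> span_fam n b J = M"

text \<open>Filtration compatible basis of a filtration M_0 \<subseteq> ... \<subseteq> M_N:
  a basis of M_N whose members lying in M_t form a basis of M_t, for all t.\<close>
definition filt_compat_basis ::
  "nat \<Rightarrow> ('j \<Rightarrow> 'a::field vec) \<Rightarrow> 'j set \<Rightarrow> (nat \<Rightarrow> 'a vec set) \<Rightarrow> nat \<Rightarrow> bool" where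
  "filt_compat_basis n b J M N \<longleftrightarrow> basis_fam n b J (M N) \<and>
     (\<forall>t\<le>N. basis_fam n b {j\<in>J. b j \<in> M t} (M t))"

text \<open>Support of m in the filtration M indexed by T = {0..N}.\<close>
definition supp :: "(nat \<Rightarrow> 'a vec set) \<Rightarrow> nat \<Rightarrow> 'a vec \<Rightarrow> nat set" where
  "supp M N m = {t. t \<le> N \<and> m \<in> M t}"

text \<open>The standard basis (e_0,...,e_{n-1}) is a filtration compatible ordered basis.\<close>
definition filt_compat_ordered_std_basis :: "nat \<Rightarrow> (nat \<Rightarrow> 'a::field vec set) \<Rightarrow> nat \<Rightarrow> bool" where
  "filt_compat_ordered_std_basis n M N \<longleftrightarrow>
     filt_compat_basis n (unit_vec n) {..<n} M N \<and>
     (\<forall>i j. i \<le> j \<and> j < n \<longrightarrow> supp M N (unit_vec n j) \<subseteq> supp M N (unit_vec n i))"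

text \<open>Filtration of chain complexes on F^n with boundary matrix D (w.r.t. the standard basis),
  graded by a degree function on the (homogeneous) basis vectors, differential of degree -1.\<close>
definition filt_chain_complex ::
  "nat \<Rightarrow> (nat \<Rightarrow> int) \<Rightarrow> 'a::field mat \<Rightarrow> (nat \<Rightarrow> 'a vec set) \<Rightarrow> nat \<Rightarrow> bool" where
  "filt_chain_complex n deg D M N \<longleftrightarrow>
     D \<in> carrier_mat n n \<and> D * D = 0\<^sub>m n n \<and>
     (\<forall>i<n. \<forall>j<n. D $$ (i,j) \<noteq> 0 \<longrightarrow> deg i + 1 = deg j) \<and>
     M N = carrier_vec n \<and>
     (\<forall>t<N. M t \<subseteq> M (Suc t)) \<and>
     (\<forall>t\<le>N. \<forall>x\<in>M t. D *\<^sub>v x \<in> M t)"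

text \<open>Pivot: largest row index of a nonzero entry (for nonzero columns).\<close>
definition piv :: "'a::zero vec \<Rightarrow> nat" where
  "piv x = Max {i. i < dim_vec x \<and> x $ i \<noteq> 0}"

definition reduced :: "'a::zero mat \<Rightarrow> bool" where
  "reduced R \<longleftrightarrow> (\<forall>j1<dim_col R. \<forall>j2<dim_col R.
      j1 \<noteq> j2 \<and> col R j1 \<noteq> 0\<^sub>v (dim_row R) \<and> col R j2 \<noteq> 0\<^sub>v (dim_row R)
      \<longrightarrow> piv (col R j1) \<noteq> piv (col R j2))"

end

theory Submission
  imports Defs "Jordan_Normal_Form.Determinant"
begin

(* Because the standard bases are filtration compatible and ordered, every C_t and C'_t is the
   coordinate subspace spanned by an initial segment of the standard basis. Write y = V^phi w.
   From F D = D' F one gets F^-1 D' = D F^-1, so F x = D' y forces x = R^phi w, and then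
   D x = 0 holds automatically; hence the t-th term of the filtration is the image under F R^phi
   of all w with V^phi w in C'_t and R^phi w in C_t. An invertible upper triangular matrix
   preserves initial-segment coordinate subspaces, so the first condition just says that w is
   supported on indices j with v^phi_j in C'_t. Since R^phi is reduced, the column with the largest
   pivot among those used by w is the only one reaching that pivot row, so R^phi w lies in C_t
   iff every column it uses does. The term is therefore spanned by the columns F r^phi_j with
   v^phi_j in C'_t and r^phi_j in C_t; the nonzero ones are independent because the nonzero
   columns of a reduced matrix are independent and F is injective. Both claims follow. *)

definition coord_subspace :: "nat \<Rightarrow> nat set \<Rightarrow> 'a::zero vec set" where
  "coord_subspace n S = {x \<in> carrier_vec n. \<forall>i<n. x $ i \<noteq> 0 \<longrightarrow> i \<in> S}"

lemma coord_subspace_empty: "coord_subspace n {} = {0\<^sub>v n}"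
  by (auto simp: coord_subspace_def vec_eq_iff)

lemma zero_in_coord_subspace: "0\<^sub>v n \<in> coord_subspace n S"
  by (simp add: coord_subspace_def)

lemma unit_vec_in_coord_subspace_iff:
  "j < n \<Longrightarrow> (unit_vec n j :: 'a::zero_neq_one vec) \<in> coord_subspace n S \<longleftrightarrow> j \<in> S"
  by (auto simp: coord_subspace_def)

lemma
  fixes x :: "'a::zero vec"
  assumes "x \<in> carrier_vec n" "x \<noteq> 0\<^sub>v n"
  shows piv_less: "piv x < n"
    and nth_piv_nonzero: "x $ piv x \<noteq> 0"
    and le_piv: "\<And>i. i < n \<Longrightarrow> x $ i \<noteq> 0 \<Longrightarrow> i \<le> piv x"
proof -
  let ?I = "{i. i < dim_vec x \<and> x $ i \<noteq> 0}"
  have "?I \<noteq> {}" using assms by (auto simp: vec_eq_iff)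
  then have "piv x \<in> ?I" unfolding piv_def by (intro Max_in) auto
  then show "piv x < n" "x $ piv x \<noteq> 0" using assms(1) by auto
  show "\<And>i. i < n \<Longrightarrow> x $ i \<noteq> 0 \<Longrightarrow> i \<le> piv x"
    unfolding piv_def using assms(1) by (intro Max_ge) auto
qed

lemma coord_subspace_lessThan_iff_piv:
  assumes "x \<in> carrier_vec n" "x \<noteq> 0\<^sub>v n"
  shows "x \<in> coord_subspace n {..<k} \<longleftrightarrow> piv x < k"
proof
  assume "x \<in> coord_subspace n {..<k}"
  then show "piv x < k"
    using piv_less[OF assms] nth_piv_nonzero[OF assms] by (auto simp: coord_subspace_def)
next
  assume "piv x < k"
  then show "x \<in> coord_subspace n {..<k}"
    using le_piv[OF assms] assms(1) by (fastforce simp: coord_subspace_def)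
qed

lemma mult_mat_vec_nth:
  "A \<in> carrier_mat n m \<Longrightarrow> w \<in> carrier_vec m \<Longrightarrow> i < n \<Longrightarrow> (A *\<^sub>v w) $ i = (\<Sum>j<m. A $$ (i,j) * w $ j)"
  by (simp add: scalar_prod_def lessThan_atLeast0)

lemma mult_mat_vec_unit_vec:
  "(A :: 'a::semiring_1 mat) \<in> carrier_mat n m \<Longrightarrow> j < m \<Longrightarrow> A *\<^sub>v unit_vec m j = col A j"
  using col_mult2[of A n m "1\<^sub>m m" m j] right_mult_one_mat[of A n m] by simp

lemma mult_mat_vec_in_coord_subspace:
  fixes A :: "'a::semiring_0 mat"
  assumes A: "A \<in> carrier_mat n m" and w: "w \<in> carrier_vec m"
    and cols: "\<And>j. j < m \<Longrightarrow> w $ j \<noteq> 0 \<Longrightarrow> col A j \<in> coord_subspace n S"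
  shows "A *\<^sub>v w \<in> coord_subspace n S"
  unfolding coord_subspace_def
proof (intro CollectI conjI allI impI)
  fix i assume i: "i < n" and "(A *\<^sub>v w) $ i \<noteq> 0"
  then obtain j where j: "j < m" "A $$ (i,j) * w $ j \<noteq> 0"
    using mult_mat_vec_nth[OF A w i] by (auto elim: sum.not_neutral_contains_not_neutral)
  then have "col A j $ i \<noteq> 0" "w $ j \<noteq> 0" using A i by auto
  then show "i \<in> S" using cols[of j] j(1) i by (auto simp: coord_subspace_def)
qed (use A w in simp)

lemma lin_comb_cols:
  assumes A: "A \<in> carrier_mat n m" and K: "K \<subseteq> {..<m}"
  shows "lin_comb n (col A) K c = A *\<^sub>v vec m (\<lambda>j. if j \<in> K then c j else 0)"
proof (rule eq_vecI)
  fix i assume "i < dim_vec (A *\<^sub>v vec m (\<lambda>j. if j \<in> K then c j else 0))"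
  then have i: "i < n" using A by simp
  have "(A *\<^sub>v vec m (\<lambda>j. if j \<in> K then c j else 0)) $ i
      = (\<Sum>j<m. A $$ (i,j) * (if j \<in> K then c j else 0))"
    by (subst mult_mat_vec_nth[OF A _ i]) auto
  also have "\<dots> = (\<Sum>j<m. if j \<in> K then A $$ (i,j) * c j else 0)"
    by (intro sum.cong) auto
  also have "\<dots> = (\<Sum>j\<in>K. A $$ (i,j) * c j)"
    using K by (simp add: sum.inter_restrict[symmetric] Int_absorb1)
  also have "\<dots> = lin_comb n (col A) K c $ i"
    unfolding lin_comb_def using A i K by (auto intro!: sum.cong simp: mult.commute)
  finally show "lin_comb n (col A) K c $ i = (A *\<^sub>v vec m (\<lambda>j. if j \<in> K then c j else 0)) $ i"
    by simp
qed (use A in \<open>simp add: lin_comb_def\<close>)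

lemma restrict_vec_in_coord_subspace:
  "w \<in> coord_subspace m K \<Longrightarrow> vec m (\<lambda>j. if j \<in> K then w $ j else 0) = w"
  by (auto simp: coord_subspace_def vec_eq_iff)

lemma span_fam_cols:
  assumes A: "A \<in> carrier_mat n m" and K: "K \<subseteq> {..<m}"
  shows "span_fam n (col A) K = (*\<^sub>v) A ` coord_subspace m K"
proof
  show "span_fam n (col A) K \<subseteq> (*\<^sub>v) A ` coord_subspace m K"
    unfolding span_fam_def lin_comb_cols[OF A K] by (auto simp: coord_subspace_def)
  show "(*\<^sub>v) A ` coord_subspace m K \<subseteq> span_fam n (col A) K"
  proof
    fix z assume "z \<in> (*\<^sub>v) A ` coord_subspace m K"
    then obtain w where "w \<in> coord_subspace m K" "z = A *\<^sub>v w" by blast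
    then have "z = lin_comb n (col A) K (($) w)"
      by (simp add: lin_comb_cols[OF A K] restrict_vec_in_coord_subspace)
    then show "z \<in> span_fam n (col A) K" unfolding span_fam_def by blast
  qed
qed

lemma lin_indep_fam_cols:
  assumes A: "A \<in> carrier_mat n m" and K: "K \<subseteq> {..<m}"
  shows "lin_indep_fam n (col A) K \<longleftrightarrow> (\<forall>w\<in>coord_subspace m K. A *\<^sub>v w = 0\<^sub>v n \<longrightarrow> w = 0\<^sub>v m)"
proof
  assume indep: "lin_indep_fam n (col A) K"
  show "\<forall>w\<in>coord_subspace m K. A *\<^sub>v w = 0\<^sub>v n \<longrightarrow> w = 0\<^sub>v m"
  proof (intro ballI impI)
    fix w assume w: "w \<in> coord_subspace m K" and "A *\<^sub>v w = 0\<^sub>v n"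
    then have "lin_comb n (col A) K (($) w) = 0\<^sub>v n"
      by (simp add: lin_comb_cols[OF A K] restrict_vec_in_coord_subspace)
    then have "\<forall>j\<in>K. w $ j = 0" using indep unfolding lin_indep_fam_def by blast
    then show "w = 0\<^sub>v m" using w by (auto simp: coord_subspace_def vec_eq_iff)
  qed
next
  assume inj: "\<forall>w\<in>coord_subspace m K. A *\<^sub>v w = 0\<^sub>v n \<longrightarrow> w = 0\<^sub>v m"
  show "lin_indep_fam n (col A) K"
    unfolding lin_indep_fam_def
  proof (intro allI impI ballI)
    fix c j assume c: "lin_comb n (col A) K c = 0\<^sub>v n" and j: "j \<in> K"
    define w where "w = vec m (\<lambda>j. if j \<in> K then c j else 0)"
    have "w \<in> coord_subspace m K" by (simp add: w_def coord_subspace_def)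
    moreover have "A *\<^sub>v w = 0\<^sub>v n" using c by (simp add: w_def lin_comb_cols[OF A K])
    ultimately have "w = 0\<^sub>v m" using inj by blast
    moreover have "j < m" using j K by blast
    ultimately show "c j = 0" using j by (auto simp: w_def vec_eq_iff dest!: spec[of _ j])
  qed
qed

lemma span_fam_nonzero_members:
  assumes "finite J"
  shows "span_fam n b {j \<in> J. b j \<noteq> 0\<^sub>v n} = span_fam n b J"
proof -
  have "lin_comb n b {j \<in> J. b j \<noteq> 0\<^sub>v n} c = lin_comb n b J c" for c
    unfolding lin_comb_def
  proof (rule eq_vecI)
    fix i assume "i < dim_vec (vec n (\<lambda>i. \<Sum>j\<in>J. c j * b j $ i))"
    then have i: "i < n" by simp
    have "(\<Sum>j\<in>{j \<in> J. b j \<noteq> 0\<^sub>v n}. c j * b j $ i) = (\<Sum>j\<in>J. c j * b j $ i)"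
      using assms i by (intro sum.mono_neutral_left) auto
    then show "vec n (\<lambda>i. \<Sum>j\<in>{j \<in> J. b j \<noteq> 0\<^sub>v n}. c j * b j $ i) $ i
      = vec n (\<lambda>i. \<Sum>j\<in>J. c j * b j $ i) $ i" using i by simp
  qed simp
  then show ?thesis unfolding span_fam_def by simp
qed

lemma span_fam_cong:
  assumes "\<And>j. j \<in> J \<Longrightarrow> b j = b' j"
  shows "span_fam n b J = span_fam n b' J"
proof -
  have "lin_comb n b J = lin_comb n b' J"
    using assms unfolding lin_comb_def by (intro ext arg_cong[where f="vec n"] sum.cong) auto
  then show ?thesis unfolding span_fam_def by simp
qed

lemma span_fam_unit_vec:
  assumes "S \<subseteq> {..<n}"
  shows "span_fam n (unit_vec n) S = (coord_subspace n S :: 'a::field vec set)"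
proof -
  have "span_fam n (unit_vec n) S = span_fam n (col (1\<^sub>m n)) S"
    using assms by (intro span_fam_cong) auto
  also have "\<dots> = (*\<^sub>v) (1\<^sub>m n) ` coord_subspace n S"
    by (rule span_fam_cols[OF one_carrier_mat assms])
  also have "\<dots> = coord_subspace n S"
    by (force simp: coord_subspace_def)
  finally show ?thesis .
qed

lemma filt_compat_ordered_std_basis_coord_subspace:
  fixes M :: "nat \<Rightarrow> 'a::field vec set"
  assumes M: "filt_compat_ordered_std_basis n M N" and t: "t \<le> N"
  obtains k where "k \<le> n" "M t = coord_subspace n {..<k}"
proof -
  define S where "S = {j \<in> {..<n}. unit_vec n j \<in> M t}"
  have M_t: "M t = coord_subspace n S"
    using M t span_fam_unit_vec[of S n]
    unfolding filt_compat_ordered_std_basis_def filt_compat_basis_def basis_fam_def S_def by auto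
  have down: "i \<in> S" if "i \<le> j" "j \<in> S" for i j
  proof -
    have "supp M N (unit_vec n j) \<subseteq> supp M N (unit_vec n i)"
      using M that unfolding filt_compat_ordered_std_basis_def S_def by auto
    then show ?thesis using that t unfolding supp_def S_def by auto
  qed
  define k where "k = (LEAST k. k \<notin> S)"
  have "n \<notin> S" by (simp add: S_def)
  then have "k \<le> n" "k \<notin> S"
    unfolding k_def by (metis Least_le, metis LeastI)
  have "S = {..<k}"
  proof
    show "S \<subseteq> {..<k}" using down \<open>k \<notin> S\<close> by (meson lessThan_iff not_le subsetI)
    show "{..<k} \<subseteq> S" unfolding k_def using not_less_Least by blast
  qed
  then show thesis using that \<open>k \<le> n\<close> M_t by blast
qed

lemma sum_lessThan_eq_single:
  fixes f :: "nat \<Rightarrow> 'a::comm_monoid_add"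
  assumes "j < m" "\<And>k. k < m \<Longrightarrow> k \<noteq> j \<Longrightarrow> f k = 0"
  shows "(\<Sum>k<m. f k) = f j"
  using assms by (subst sum.remove[of _ j]) (auto intro!: sum.neutral)

lemma invertible_mat_right_inverse:
  assumes "A \<in> carrier_mat n n" "invertible_mat A"
  obtains B where "B \<in> carrier_mat n n" "A * B = 1\<^sub>m n"
proof -
  obtain B where AB: "A * B = 1\<^sub>m n" and BA: "B * A = 1\<^sub>m (dim_row B)"
    using assms unfolding invertible_mat_def inverts_mat_def by auto
  have "dim_col B = n" using arg_cong[OF AB, of dim_col] by simp
  moreover have "dim_row B = n" using arg_cong[OF BA, of dim_col] assms(1) by simp
  ultimately show thesis using that AB by blast
qed

lemma upper_triangular_invertible_diag_nonzero:
  fixes A :: "'a::field mat"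
  assumes A: "A \<in> carrier_mat n n" "invertible_mat A" "upper_triangular A" and i: "i < n"
  shows "A $$ (i,i) \<noteq> 0"
proof -
  obtain B where B: "B \<in> carrier_mat n n" "A * B = 1\<^sub>m n"
    using A(1,2) by (rule invertible_mat_right_inverse)
  have "det A * det B = 1" using det_mult[OF A(1) B(1)] B(2) by simp
  then have "0 \<notin> set (diag_mat A)" using upper_triangular_imp_det_eq_0_iff[OF A(1,3)] by auto
  then show ?thesis using A(1) i by (auto simp: diag_mat_def)
qed

lemma upper_triangular_mult_vec_in_coord_subspace:
  fixes A :: "'a::semiring_0 mat"
  assumes A: "A \<in> carrier_mat n n" "upper_triangular A" and x: "x \<in> coord_subspace n {..<k}"
  shows "A *\<^sub>v x \<in> coord_subspace n {..<k}"
proof (rule mult_mat_vec_in_coord_subspace[OF A(1)])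
  show x_carr: "x \<in> carrier_vec n" using x by (simp add: coord_subspace_def)
  fix j assume j: "j < n" "x $ j \<noteq> 0"
  then have "j < k" using x by (auto simp: coord_subspace_def)
  show "col A j \<in> coord_subspace n {..<k}"
    unfolding coord_subspace_def
  proof (intro CollectI conjI allI impI)
    fix i assume i: "i < n" "col A j $ i \<noteq> 0"
    then have "\<not> j < i" using upper_triangularD[OF A(2), of j i] A(1) j(1) by auto
    then show "i \<in> {..<k}" using \<open>j < k\<close> by simp
  qed (rule col_carrier_vec[OF j(1) A(1)])
qed

lemma upper_triangular_mult_vec_coord_subspace_iff:
  fixes A :: "'a::semiring_no_zero_divisors mat"
  assumes A: "A \<in> carrier_mat n n" "upper_triangular A" and diag: "\<And>i. i < n \<Longrightarrow> A $$ (i,i) \<noteq> 0"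
    and x: "x \<in> carrier_vec n"
  shows "A *\<^sub>v x \<in> coord_subspace n {..<k} \<longleftrightarrow> x \<in> coord_subspace n {..<k}"
proof
  assume Ax: "A *\<^sub>v x \<in> coord_subspace n {..<k}"
  show "x \<in> coord_subspace n {..<k}"
  proof (rule ccontr)
    assume x_notin: "x \<notin> coord_subspace n {..<k}"
    then have x0: "x \<noteq> 0\<^sub>v n" by (metis zero_in_coord_subspace)
    let ?p = "piv x"
    have p: "?p < n" "k \<le> ?p"
      using piv_less[OF x x0] coord_subspace_lessThan_iff_piv[OF x x0] x_notin by auto
    have "(A *\<^sub>v x) $ ?p = (\<Sum>j<n. A $$ (?p,j) * x $ j)" by (rule mult_mat_vec_nth[OF A(1) x p(1)])
    also have "\<dots> = A $$ (?p,?p) * x $ ?p"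
    proof (rule sum_lessThan_eq_single[OF p(1)])
      fix j assume j: "j < n" "j \<noteq> ?p"
      show "A $$ (?p,j) * x $ j = 0"
      proof (cases "j < ?p")
        case True
        then show ?thesis using A p(1) by auto
      next
        case False
        then have "x $ j = 0" using le_piv[OF x x0 j(1)] j(2) by fastforce
        then show ?thesis by simp
      qed
    qed
    finally have "(A *\<^sub>v x) $ ?p \<noteq> 0" using diag[OF p(1)] nth_piv_nonzero[OF x x0] by simp
    then show False using Ax p by (auto simp: coord_subspace_def)
  qed
qed (rule upper_triangular_mult_vec_in_coord_subspace[OF A])

lemma upper_triangular_col_in_coord_subspace_iff:
  fixes A :: "'a::{semiring_no_zero_divisors, semiring_1} mat"
  assumes A: "A \<in> carrier_mat n n" "upper_triangular A" "\<And>i. i < n \<Longrightarrow> A $$ (i,i) \<noteq> 0"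
    and j: "j < n"
  shows "col A j \<in> coord_subspace n {..<k} \<longleftrightarrow> j < k"
proof -
  have "col A j \<in> coord_subspace n {..<k} \<longleftrightarrow> (unit_vec n j :: 'a vec) \<in> coord_subspace n {..<k}"
    using upper_triangular_mult_vec_coord_subspace_iff[OF A unit_vec_carrier, of j k]
      mult_mat_vec_unit_vec[OF A(1) j] by simp
  also have "\<dots> \<longleftrightarrow> j < k" by (simp add: unit_vec_in_coord_subspace_iff[OF j])
  finally show ?thesis .
qed

lemma reduced_mult_vec_max_piv:
  fixes R :: "'a::semiring_no_zero_divisors mat"
  assumes R: "R \<in> carrier_mat n m" "reduced R" and w: "w \<in> carrier_vec m"
    and j: "j < m" "w $ j \<noteq> 0" "col R j \<noteq> 0\<^sub>v n"
  obtains j0 where "j0 < m" "col R j0 \<noteq> 0\<^sub>v n" "piv (col R j) \<le> piv (col R j0)"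
    "(R *\<^sub>v w) $ piv (col R j0) \<noteq> 0"
proof -
  \<comment> \<open>Pivots of nonzero columns are distinct, so only the used column of maximal pivot
    contributes to its pivot row.\<close>
  let ?P = "\<lambda>j. j < m \<and> w $ j \<noteq> 0 \<and> col R j \<noteq> 0\<^sub>v n"
  have col_R: "col R j \<in> carrier_vec n" for j using R(1) by (metis carrier_matD(1) col_dim)
  have "\<forall>j. ?P j \<longrightarrow> piv (col R j) < n" using piv_less[OF col_R] by blast
  then obtain j0 where j0: "?P j0" and max: "\<And>j. ?P j \<Longrightarrow> piv (col R j) \<le> piv (col R j0)"
    using ex_has_greatest_nat[of ?P j "\<lambda>j. piv (col R j)" n] j by blast
  let ?p = "piv (col R j0)"
  have p: "?p < n" using piv_less[OF col_R] j0 by blast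
  have "R $$ (?p, j0) \<noteq> 0" using nth_piv_nonzero[OF col_R, of j0] j0 R(1) p by auto
  have "(R *\<^sub>v w) $ ?p = (\<Sum>k<m. R $$ (?p,k) * w $ k)" by (rule mult_mat_vec_nth[OF R(1) w p(1)])
  also have "\<dots> = R $$ (?p,j0) * w $ j0"
  proof (rule sum_lessThan_eq_single)
    fix k assume k: "k < m" "k \<noteq> j0"
    show "R $$ (?p,k) * w $ k = 0"
    proof (cases "?P k")
      case True
      then have "piv (col R k) \<noteq> ?p"
        using R j0 k unfolding reduced_def by auto
      then have "piv (col R k) < ?p" using max[OF True] by simp
      then have "col R k $ ?p = 0" using le_piv[OF col_R, of k ?p] True p(1) by fastforce
      then show ?thesis using R(1) p(1) k(1) by simp
    next
      case False
      then have "w $ k = 0 \<or> col R k $ ?p = 0" using k(1) p by auto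
      then show ?thesis using R(1) p(1) k(1) by auto
    qed
  qed (use j0 in simp)
  finally have "(R *\<^sub>v w) $ ?p \<noteq> 0" using \<open>R $$ (?p, j0) \<noteq> 0\<close> j0 by simp
  then show thesis using that j0 max[of j] j by blast
qed

lemma reduced_mult_vec_coord_subspace_iff:
  fixes R :: "'a::semiring_no_zero_divisors mat"
  assumes R: "R \<in> carrier_mat n m" "reduced R" and w: "w \<in> carrier_vec m"
  shows "R *\<^sub>v w \<in> coord_subspace n {..<k} \<longleftrightarrow>
    (\<forall>j<m. w $ j \<noteq> 0 \<longrightarrow> col R j \<in> coord_subspace n {..<k})"
proof
  assume Rw: "R *\<^sub>v w \<in> coord_subspace n {..<k}"
  show "\<forall>j<m. w $ j \<noteq> 0 \<longrightarrow> col R j \<in> coord_subspace n {..<k}"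
  proof (intro allI impI, rule ccontr)
    fix j assume j: "j < m" "w $ j \<noteq> 0" and col_notin: "col R j \<notin> coord_subspace n {..<k}"
    then have col_nz: "col R j \<noteq> 0\<^sub>v n" by (metis zero_in_coord_subspace)
    have col_R: "col R j \<in> carrier_vec n" using R(1) by (metis carrier_matD(1) col_dim)
    have "k \<le> piv (col R j)"
      using coord_subspace_lessThan_iff_piv[OF col_R col_nz] col_notin by simp
    obtain j0 where "j0 < m" "col R j0 \<noteq> 0\<^sub>v n" "piv (col R j) \<le> piv (col R j0)"
      and Rw_p: "(R *\<^sub>v w) $ piv (col R j0) \<noteq> 0"
      using reduced_mult_vec_max_piv[OF R w j col_nz] .
    moreover have "piv (col R j0) < n" using piv_less R(1) \<open>col R j0 \<noteq> 0\<^sub>v n\<close>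
      by (metis carrier_matD(1) col_dim)
    ultimately show False using Rw \<open>k \<le> piv (col R j)\<close> by (auto simp: coord_subspace_def)
  qed
qed (use mult_mat_vec_in_coord_subspace[OF R(1) w] in blast)

definition nonzero_cols_independent :: "'a::semiring_0 mat \<Rightarrow> bool" where
  "nonzero_cols_independent A \<longleftrightarrow> (\<forall>w\<in>carrier_vec (dim_col A). A *\<^sub>v w = 0\<^sub>v (dim_row A) \<longrightarrow>
     (\<forall>j<dim_col A. w $ j \<noteq> 0 \<longrightarrow> col A j = 0\<^sub>v (dim_row A)))"

lemma reduced_imp_nonzero_cols_independent:
  fixes R :: "'a::semiring_no_zero_divisors mat"
  assumes "reduced R"
  shows "nonzero_cols_independent R"
  unfolding nonzero_cols_independent_def
  using reduced_mult_vec_coord_subspace_iff[OF carrier_matI[OF refl refl] assms, of _ 0]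
  by (simp add: coord_subspace_empty)

lemma mult_mat_vec_eq_zero_iff_left_invertible:
  fixes F Finv :: "'a::semiring_1 mat"
  assumes F: "F \<in> carrier_mat n n" "Finv \<in> carrier_mat n n" "Finv * F = 1\<^sub>m n"
    and x: "x \<in> carrier_vec n"
  shows "F *\<^sub>v x = 0\<^sub>v n \<longleftrightarrow> x = 0\<^sub>v n"
proof
  assume "F *\<^sub>v x = 0\<^sub>v n"
  then have "Finv *\<^sub>v (F *\<^sub>v x) = 0\<^sub>v n" using F(2) by (auto simp: scalar_prod_def)
  then show "x = 0\<^sub>v n" using assoc_mult_mat_vec[OF F(2,1) x] F(3) x by simp
qed (use F(1) in \<open>auto simp: scalar_prod_def\<close>)

lemma nonzero_cols_independent_mult_left:
  fixes F Finv A :: "'a::comm_ring_1 mat"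
  assumes F: "F \<in> carrier_mat n n" "Finv \<in> carrier_mat n n" "Finv * F = 1\<^sub>m n"
    and A: "A \<in> carrier_mat n m" "nonzero_cols_independent A"
  shows "nonzero_cols_independent (F * A)"
  unfolding nonzero_cols_independent_def
proof (intro ballI impI allI)
  fix w j assume w: "w \<in> carrier_vec (dim_col (F * A))"
    and FAw: "F * A *\<^sub>v w = 0\<^sub>v (dim_row (F * A))"
    and j: "j < dim_col (F * A)" "w $ j \<noteq> 0"
  have w: "w \<in> carrier_vec m" and j: "j < m" using w j A(1) by auto
  have "F *\<^sub>v (A *\<^sub>v w) = 0\<^sub>v n" using FAw assoc_mult_mat_vec[OF F(1) A(1) w] F(1) by simp
  then have "A *\<^sub>v w = 0\<^sub>v n"
    using mult_mat_vec_eq_zero_iff_left_invertible[OF F] A(1) w by simp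
  then have "col A j = 0\<^sub>v n"
    using A j \<open>w $ j \<noteq> 0\<close> w unfolding nonzero_cols_independent_def by auto
  then show "col (F * A) j = 0\<^sub>v (dim_row (F * A))" using F(1) A(1) j by auto
qed

lemma basis_fam_nonzero_cols:
  fixes A :: "'a::field mat"
  assumes A: "A \<in> carrier_mat n m" "nonzero_cols_independent A" and S: "S \<subseteq> {..<m}"
  shows "basis_fam n (col A) {j \<in> S. col A j \<noteq> 0\<^sub>v n} ((*\<^sub>v) A ` coord_subspace m S)"
proof -
  let ?K = "{j \<in> S. col A j \<noteq> 0\<^sub>v n}"
  have K: "?K \<subseteq> {..<m}" and fin: "finite S" using S finite_subset by auto
  have "span_fam n (col A) ?K = (*\<^sub>v) A ` coord_subspace m S"
    unfolding span_fam_nonzero_members[OF fin] by (rule span_fam_cols[OF A(1) S])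
  moreover have "lin_indep_fam n (col A) ?K"
    unfolding lin_indep_fam_cols[OF A(1) K]
  proof (intro ballI impI)
    fix w assume w: "w \<in> coord_subspace m ?K" and "A *\<^sub>v w = 0\<^sub>v n"
    then have zero_cols: "\<forall>j<m. w $ j \<noteq> 0 \<longrightarrow> col A j = 0\<^sub>v n"
      using A unfolding nonzero_cols_independent_def coord_subspace_def by auto
    have "w $ j = 0" if "j < m" for j
      using zero_cols w that by (auto simp: coord_subspace_def)
    then show "w = 0\<^sub>v m" using w by (auto simp: coord_subspace_def vec_eq_iff)
  qed
  moreover have "\<forall>j\<in>?K. col A j \<in> carrier_vec n" using A(1) K by auto
  ultimately show ?thesis unfolding basis_fam_def using fin by auto
qed

lemma nonzero_col_in_image_coord_subspace_iff:
  fixes A :: "'a::comm_ring_1 mat"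
  assumes A: "A \<in> carrier_mat n m" "nonzero_cols_independent A"
    and j: "j < m" "col A j \<noteq> 0\<^sub>v n"
  shows "col A j \<in> (*\<^sub>v) A ` coord_subspace m S \<longleftrightarrow> j \<in> S"
proof
  assume "col A j \<in> (*\<^sub>v) A ` coord_subspace m S"
  then obtain w where w: "w \<in> coord_subspace m S" "col A j = A *\<^sub>v w" by blast
  show "j \<in> S"
  proof (rule ccontr)
    assume "j \<notin> S"
    let ?u = "unit_vec m j - w"
    have w_carr: "w \<in> carrier_vec m" using w(1) by (simp add: coord_subspace_def)
    have "A *\<^sub>v ?u = 0\<^sub>v n"
      using mult_minus_distrib_mat_vec[OF A(1) unit_vec_carrier w_carr] w(2)
        mult_mat_vec_unit_vec[OF A(1) j(1)] A(1) w_carr by simp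
    moreover have "?u $ j \<noteq> 0" using \<open>j \<notin> S\<close> w(1) j(1) by (auto simp: coord_subspace_def)
    ultimately have "col A j = 0\<^sub>v n"
      using A j(1) w_carr unfolding nonzero_cols_independent_def by auto
    then show False using j(2) by contradiction
  qed
next
  assume "j \<in> S"
  then have "unit_vec m j \<in> coord_subspace m S" using j(1) by (auto simp: coord_subspace_def)
  then show "col A j \<in> (*\<^sub>v) A ` coord_subspace m S"
    using mult_mat_vec_unit_vec[OF A(1) j(1)] by (metis image_eqI)
qed

lemma filt_compat_basis_nonzero_cols:
  fixes A :: "'a::field mat"
  assumes A: "A \<in> carrier_mat n m" "nonzero_cols_independent A"
    and G: "\<forall>t\<le>N. G t = (*\<^sub>v) A ` coord_subspace m (S t)"
    and S: "\<And>t. S t \<subseteq> {..<m}" "S N = {..<m}"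
  shows "filt_compat_basis n (col A) {j. j < m \<and> col A j \<noteq> 0\<^sub>v n} G N"
proof -
  let ?J = "{j. j < m \<and> col A j \<noteq> 0\<^sub>v n}"
  have basis: "basis_fam n (col A) {j \<in> S t. col A j \<noteq> 0\<^sub>v n} (G t)" if "t \<le> N" for t
    using basis_fam_nonzero_cols[OF A S(1)] G that by simp
  have "{j \<in> ?J. col A j \<in> G t} = {j \<in> S t. col A j \<noteq> 0\<^sub>v n}" if "t \<le> N" for t
  proof -
    have "col A j \<in> G t \<longleftrightarrow> j \<in> S t" if "j \<in> ?J" for j
      using nonzero_col_in_image_coord_subspace_iff[OF A] G \<open>t \<le> N\<close> that by simp
    then show ?thesis using S(1)[of t] by blast
  qed
  moreover have "?J = {j \<in> S N. col A j \<noteq> 0\<^sub>v n}" using S(2) by auto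
  ultimately show ?thesis unfolding filt_compat_basis_def using basis by simp
qed

lemma supp_nonzero_col:
  fixes A :: "'a::comm_ring_1 mat"
  assumes A: "A \<in> carrier_mat n m" "nonzero_cols_independent A"
    and G: "\<forall>t\<le>N. G t = (*\<^sub>v) A ` coord_subspace m (S t)"
    and j: "j < m" "col A j \<noteq> 0\<^sub>v n"
  shows "supp G N (col A j) = {t. t \<le> N \<and> j \<in> S t}"
  using nonzero_col_in_image_coord_subspace_iff[OF A j] G unfolding supp_def by auto

lemma coord_subspace_preimage_upper_triangular_reduced:
  fixes V R :: "'a::semiring_no_zero_divisors mat"
  assumes V: "V \<in> carrier_mat m m" "upper_triangular V" "\<And>i. i < m \<Longrightarrow> V $$ (i,i) \<noteq> 0"
    and R: "R \<in> carrier_mat n m" "reduced R"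
  shows "{w \<in> carrier_vec m. V *\<^sub>v w \<in> coord_subspace m {..<k'} \<and> R *\<^sub>v w \<in> coord_subspace n {..<k}}
    = coord_subspace m {j. j < k' \<and> col R j \<in> coord_subspace n {..<k}}"
    (is "?lhs = ?rhs")
proof (intro equalityI subsetI)
  fix w assume "w \<in> ?lhs"
  then have "w \<in> coord_subspace m {..<k'}" "\<forall>j<m. w $ j \<noteq> 0 \<longrightarrow> col R j \<in> coord_subspace n {..<k}"
    using upper_triangular_mult_vec_coord_subspace_iff[OF V]
      reduced_mult_vec_coord_subspace_iff[OF R] by auto
  then show "w \<in> ?rhs" by (auto simp: coord_subspace_def)
next
  fix w assume "w \<in> ?rhs"
  then have "w \<in> carrier_vec m" "w \<in> coord_subspace m {..<k'}"
    "\<forall>j<m. w $ j \<noteq> 0 \<longrightarrow> col R j \<in> coord_subspace n {..<k}"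
    by (auto simp: coord_subspace_def)
  then show "w \<in> ?lhs"
    using upper_triangular_mult_vec_coord_subspace_iff[OF V]
      reduced_mult_vec_coord_subspace_iff[OF R] by auto
qed

lemma chain_iso_mult_identities:
  fixes D D' F Finv V :: "'a::semiring_1 mat"
  assumes carrier: "D \<in> carrier_mat n n" "D' \<in> carrier_mat n n" "F \<in> carrier_mat n n"
      "Finv \<in> carrier_mat n n" "V \<in> carrier_mat n n"
    and F_inv: "Finv * F = 1\<^sub>m n" "F * Finv = 1\<^sub>m n"
    and chain: "F * D = D' * F" and DD: "D * D = 0\<^sub>m n n"
  shows "Finv * D' = D * Finv" "F * (D * Finv * V) = D' * V" "D * (D * Finv * V) = 0\<^sub>m n n"
proof -
  note assoc = assoc_mult_mat[of _ n n _ n _ n]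
  have "Finv * D' = Finv * D' * (F * Finv)" using carrier F_inv(2) by simp
  also have "\<dots> = Finv * (D' * F) * Finv" using carrier by (simp only: assoc mult_carrier_mat)
  also have "\<dots> = (Finv * F) * D * Finv" using carrier by (simp only: chain assoc mult_carrier_mat)
  finally show "Finv * D' = D * Finv" using carrier F_inv(1) by simp
  have "F * (D * Finv * V) = (F * D) * Finv * V"
    using carrier by (simp only: assoc mult_carrier_mat)
  also have "\<dots> = D' * (F * Finv) * V" using carrier by (simp only: chain assoc mult_carrier_mat)
  finally show "F * (D * Finv * V) = D' * V" using carrier F_inv(2) by simp
  have "D * (D * Finv * V) = (D * D) * (Finv * V)"
    using carrier by (simp only: assoc mult_carrier_mat)
  then show "D * (D * Finv * V) = 0\<^sub>m n n" using carrier DD by simp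
qed

lemma image_cycles_inter_boundaries:
  fixes D D' F Finv V :: "'a::comm_ring_1 mat"
  assumes carrier: "D \<in> carrier_mat n n" "D' \<in> carrier_mat n n" "F \<in> carrier_mat n n"
      "Finv \<in> carrier_mat n n" "V \<in> carrier_mat n n"
    and F_inv: "Finv * F = 1\<^sub>m n" "F * Finv = 1\<^sub>m n" and V: "invertible_mat V"
    and chain: "F * D = D' * F" and DD: "D * D = 0\<^sub>m n n"
    and XY: "X \<subseteq> carrier_vec n" "Y \<subseteq> carrier_vec n"
  shows "{F *\<^sub>v x | x. x \<in> X \<and> D *\<^sub>v x = 0\<^sub>v n} \<inter> {D' *\<^sub>v y | y. y \<in> Y}
    = (*\<^sub>v) (F * (D * Finv * V)) ` {w \<in> carrier_vec n. V *\<^sub>v w \<in> Y \<and> D * Finv * V *\<^sub>v w \<in> X}"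
    (is "?lhs = (*\<^sub>v) (F * ?R) ` ?W")
proof -
  have R: "?R \<in> carrier_mat n n" using carrier by simp
  note identities = chain_iso_mult_identities[OF carrier F_inv chain DD]
  show ?thesis
  proof (intro equalityI subsetI)
    fix z assume "z \<in> ?lhs"
    then obtain x y where x: "x \<in> X" "z = F *\<^sub>v x" and y: "y \<in> Y" "z = D' *\<^sub>v y" by blast
    have x_carr: "x \<in> carrier_vec n" and y_carr: "y \<in> carrier_vec n" using x y XY by auto
    obtain B where B: "B \<in> carrier_mat n n" "V * B = 1\<^sub>m n"
      using carrier(5) V by (rule invertible_mat_right_inverse)
    define w where "w = B *\<^sub>v y"
    have w: "w \<in> carrier_vec n" "V *\<^sub>v w = y"
      using carrier B y_carr by (auto simp: w_def assoc_mult_mat_vec[symmetric])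
    have "x = Finv *\<^sub>v (F *\<^sub>v x)"
      using carrier F_inv(1) x_carr by (simp add: assoc_mult_mat_vec[symmetric])
    also have "\<dots> = (Finv * D') *\<^sub>v y" using carrier x y y_carr by simp
    also have "\<dots> = (D * Finv) *\<^sub>v (V *\<^sub>v w)" using identities(1) w(2) by simp
    also have "\<dots> = ?R *\<^sub>v w" using carrier w(1) by (intro assoc_mult_mat_vec[symmetric]) auto
    finally have x_eq: "x = ?R *\<^sub>v w" .
    have "z = (F * ?R) *\<^sub>v w" using x_eq x(2) assoc_mult_mat_vec[OF carrier(3) R w(1)] by simp
    moreover have "w \<in> ?W" using x_eq x(1) y(1) w by simp
    ultimately show "z \<in> (*\<^sub>v) (F * ?R) ` ?W" by blast
  next
    fix z assume "z \<in> (*\<^sub>v) (F * ?R) ` ?W"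
    then obtain w where w: "w \<in> carrier_vec n" "V *\<^sub>v w \<in> Y" "?R *\<^sub>v w \<in> X"
      and z: "z = (F * ?R) *\<^sub>v w" by blast
    have "D *\<^sub>v (?R *\<^sub>v w) = (D * ?R) *\<^sub>v w" using assoc_mult_mat_vec[OF carrier(1) R w(1)] by simp
    also have "\<dots> = 0\<^sub>v n"
      unfolding identities(3) using w(1) by (intro eq_vecI) (auto simp: scalar_prod_def)
    finally have "D *\<^sub>v (?R *\<^sub>v w) = 0\<^sub>v n" .
    moreover have "z = F *\<^sub>v (?R *\<^sub>v w)" using z assoc_mult_mat_vec[OF carrier(3) R w(1)] by simp
    moreover have "z = D' *\<^sub>v (V *\<^sub>v w)"
      using z identities(2) assoc_mult_mat_vec[OF carrier(2) carrier(5) w(1)] by simp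
    ultimately show "z \<in> ?lhs" using w by blast
  qed
qed

lemma filt_cycles_inter_boundaries_eq_image:
  fixes C C' :: "nat \<Rightarrow> 'a::field vec set" and D D' F Finv V :: "'a mat"
  assumes Cb: "filt_compat_ordered_std_basis n C N" and C'b: "filt_compat_ordered_std_basis n C' N"
    and t: "t \<le> N"
    and carrier: "D \<in> carrier_mat n n" "D' \<in> carrier_mat n n" "F \<in> carrier_mat n n"
      "Finv \<in> carrier_mat n n" "V \<in> carrier_mat n n"
    and F_inv: "Finv * F = 1\<^sub>m n" "F * Finv = 1\<^sub>m n"
    and chain: "F * D = D' * F" and DD: "D * D = 0\<^sub>m n n"
    and V: "invertible_mat V" "upper_triangular V" and R: "reduced (D * Finv * V)"
  shows "{F *\<^sub>v x | x. x \<in> C t \<and> D *\<^sub>v x = 0\<^sub>v n} \<inter> {D' *\<^sub>v y | y. y \<in> C' t}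
    = (*\<^sub>v) (F * (D * Finv * V)) `
        coord_subspace n {j. j < n \<and> col V j \<in> C' t \<and> col (D * Finv * V) j \<in> C t}"
proof -
  let ?R = "D * Finv * V"
  have R_carr: "?R \<in> carrier_mat n n" using carrier by simp
  have V_diag: "\<And>i. i < n \<Longrightarrow> V $$ (i,i) \<noteq> 0"
    using upper_triangular_invertible_diag_nonzero[OF carrier(5) V] .
  obtain k where k: "C t = coord_subspace n {..<k}"
    using filt_compat_ordered_std_basis_coord_subspace[OF Cb t] by blast
  obtain k' where k': "k' \<le> n" "C' t = coord_subspace n {..<k'}"
    using filt_compat_ordered_std_basis_coord_subspace[OF C'b t] by blast
  have "{F *\<^sub>v x | x. x \<in> C t \<and> D *\<^sub>v x = 0\<^sub>v n} \<inter> {D' *\<^sub>v y | y. y \<in> C' t}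
    = (*\<^sub>v) (F * ?R) ` {w \<in> carrier_vec n. V *\<^sub>v w \<in> C' t \<and> ?R *\<^sub>v w \<in> C t}"
    by (rule image_cycles_inter_boundaries[OF carrier F_inv V(1) chain DD])
      (auto simp: k k'(2) coord_subspace_def)
  also have "{w \<in> carrier_vec n. V *\<^sub>v w \<in> C' t \<and> ?R *\<^sub>v w \<in> C t}
    = coord_subspace n {j. j < k' \<and> col ?R j \<in> C t}"
    unfolding k k'(2)
    by (rule coord_subspace_preimage_upper_triangular_reduced[OF carrier(5) V(2) V_diag R_carr R])
  also have "{j. j < k' \<and> col ?R j \<in> C t} = {j. j < n \<and> col V j \<in> C' t \<and> col ?R j \<in> C t}"
    using k' upper_triangular_col_in_coord_subspace_iff[OF carrier(5) V(2) V_diag] by auto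
  finally show ?thesis .
qed

theorem lemma3p9:
  fixes n N :: nat
    and C C' :: "nat \<Rightarrow> 'a::field vec set"
    and deg deg' :: "nat \<Rightarrow> int"
    and D D' F Finv Dphi V Vphi R Rphi :: "'a mat"
  assumes C: "filt_chain_complex n deg D C N"
    and C': "filt_chain_complex n deg' D' C' N"
    and Cb: "filt_compat_ordered_std_basis n C N"
    and C'b: "filt_compat_ordered_std_basis n C' N"
    and F: "F \<in> carrier_mat n n" "invertible_mat F"
    and F_chain: "F * D = D' * F"
    and F_deg: "\<forall>i<n. \<forall>j<n. F $$ (i,j) \<noteq> 0 \<longrightarrow> deg' i = deg j"
    and F_filt: "\<forall>t\<le>N. \<forall>x\<in>C t. F *\<^sub>v x \<in> C' t"
    and Finv: "Finv \<in> carrier_mat n n" "F * Finv = 1\<^sub>m n" "Finv * F = 1\<^sub>m n"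
    and Dphi: "Dphi = D * Finv"
    and V: "V \<in> carrier_mat n n" "invertible_mat V" "upper_triangular V"
    and Vphi: "Vphi \<in> carrier_mat n n" "invertible_mat Vphi" "upper_triangular Vphi"
    and R: "R = D * V" "reduced R"
    and Rphi: "Rphi = Dphi * Vphi" "reduced Rphi"
  shows "let G = (\<lambda>t. {F *\<^sub>v x | x. x \<in> C t \<and> D *\<^sub>v x = 0\<^sub>v n} \<inter> {D' *\<^sub>v y | y. y \<in> C' t});
             J = {j. j < n \<and> col (F * Rphi) j \<noteq> 0\<^sub>v n}
         in filt_compat_basis n (\<lambda>j. col (F * Rphi) j) J G N \<and>
            (\<forall>j<n. col Rphi j \<noteq> 0\<^sub>v n \<longrightarrow>
               supp G N (col (F * Rphi) j) = supp C N (col Rphi j) \<inter> supp C' N (col Vphi j))"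
proof -
  have D: "D \<in> carrier_mat n n" "D * D = 0\<^sub>m n n" "C N = carrier_vec n"
    and D': "D' \<in> carrier_mat n n" "C' N = carrier_vec n"
    using C C' unfolding filt_chain_complex_def by auto
  have Rphi_eq: "Rphi = D * Finv * Vphi" and Rphi_carr: "Rphi \<in> carrier_mat n n"
    using Rphi(1) Dphi D(1) Finv(1) Vphi(1) by auto
  have A: "F * Rphi \<in> carrier_mat n n" "nonzero_cols_independent (F * Rphi)"
    using nonzero_cols_independent_mult_left[OF F(1) Finv(1,3) Rphi_carr
        reduced_imp_nonzero_cols_independent[OF Rphi(2)]] F(1) Rphi_carr by auto
  define G where "G = (\<lambda>t. {F *\<^sub>v x | x. x \<in> C t \<and> D *\<^sub>v x = 0\<^sub>v n} \<inter> {D' *\<^sub>v y | y. y \<in> C' t})"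
  define S where "S t = {j. j < n \<and> col Vphi j \<in> C' t \<and> col Rphi j \<in> C t}" for t
  have G_eq: "\<forall>t\<le>N. G t = (*\<^sub>v) (F * Rphi) ` coord_subspace n (S t)"
    using filt_cycles_inter_boundaries_eq_image[OF Cb C'b _ D(1) D'(1) F(1) Finv(1) Vphi(1)
        Finv(3,2) F_chain D(2) Vphi(2,3)] Rphi(2)
    unfolding G_def S_def Rphi_eq by simp
  have S: "S t \<subseteq> {..<n}" "S N = {..<n}" for t
    unfolding S_def D(3) D'(2) using Vphi(1) Rphi_carr by auto
  have "supp G N (col (F * Rphi) j) = supp C N (col Rphi j) \<inter> supp C' N (col Vphi j)"
    if "j < n" "col Rphi j \<noteq> 0\<^sub>v n" for j
  proof -
    have "col (F * Rphi) j \<noteq> 0\<^sub>v n"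
      using that col_mult2[OF F(1) Rphi_carr that(1)] Rphi_carr
        mult_mat_vec_eq_zero_iff_left_invertible[OF F(1) Finv(1,3)] by simp
    then show ?thesis
      using supp_nonzero_col[OF A G_eq that(1)] that(1) unfolding S_def supp_def by auto
  qed
  then show ?thesis
    using filt_compat_basis_nonzero_cols[OF A G_eq S] unfolding Let_def G_def[symmetric] by blast
qed

end
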